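(* (1) Since every recurrent point is $\mathcal F_{ip}$-recurrent, every transitive system is $\mathcal F_{ip}$-point center. Thus, a system $(X,T)$ is transitive if and only if it is $b\mathcal F_{ip}$-point transitive. (2) Let $(X,T)$ be a system and $\mathcal F$ a family. If $(X,T)$ is $\mathcal F$-point transitive, then it is $\mathcal F$-point center, and $Trans_{b\mathcal F}(X,T)=Trans(X,T)$. In particular, if $b\mathcal F=\mathcal F$, then $(X,T)$ is $\mathcal F$-point transitive if and only if $Trans_{\mathcal F}(X,T)=Trans(X,T)\neq\emptyset$.
   Context: A system (topological dynamical system) is a pair $(X,T)$ with $X$ a nonempty compact metric space and $T:X\to X$ continuous. "Opene" means nonempty open. For opene $U,V\subset X$ and $x\in X$: $N(U,V)=\{n\in\mathbb Z_+: U\cap T^{-n}V\ne\emptyset\}$ and $N(x,U)=\{n\in\mathbb Z_+: T^nx\in U\}$. $(X,T)$ is transitive if $N(U,V)$ is infinite for all opene $U,V$. Let $\omega(x,T)$ be the $\omega$-limit set of $x$ (the limit set of the orbit $x,Tx,T^2x,\dots$). A point $x$ is recurrent if $x\in\omega(x,T)$, and a transitive point if $\omega(x,T)=X$; $Trans(X,T)$ is the set of transitive points. A family is a collection $\mathcal F$ of subsets of $\mathbb Z_+$ that is hereditary upward ($F_1\subset F_2$ and $F_1\in\mathcal F$ imply $F_2\in\mathcal F$); all families are assumed to be proper (neither empty nor the collection of all subsets of $\mathbb Z_+$) and to consist of infinite sets. A set $F\subset\mathbb Z_+$ is an IP set if there is a sequence $\{p_i\}_{i=1}^\infty$ of positive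 integers such that $F$ contains all sums $\sum_{i\in\alpha}p_i$ with $\alpha$ a nonempty finite subset of $\mathbb N$; $\mathcal F_{ip}$ is the family of IP sets. The block family $b\mathcal F$ of a family $\mathcal F$ consists of all $F\subset\mathbb Z_+$ for which there is $F'\in\mathcal F$ such that for every finite $W\subset F'$ there is $m\in\mathbb Z_+$ with $m+W\subset F$. For a family $\mathcal F$: a point $x$ is $\mathcal F$-recurrent if $N(x,U)\in\mathcal F$ for every neighborhood $U$ of $x$; $x$ is an $\mathcal F$-transitive point if $N(x,U)\in\mathcal F$ for every opene $U\subset X$; $Trans_{\mathcal F}(X,T)$ is the set of $\mathcal F$-transitive points; $(X,T)$ is $\mathcal F$-point transitive if $Trans_{\mathcal F}(X,T)\neq\emptyset$; $(X,T)$ is $\mathcal F$-point center if for every opene $U\subset X$ there is $x\in U$ with $N(x,U)\in\mathcal F$. *)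

theory Defs
  imports "HOL-Analysis.Analysis"
begin

text \<open>
  The phase space is a subset \<open>X\<close> of a metric space type, with the induced metric; open subsets
  of the space \<open>X\<close> are the sets \<open>U\<close> with \<open>openin (top_of_set X) U\<close>. The values of \<open>T\<close> outside
  \<open>X\<close> are irrelevant. \<open>\<int>\<^sub>+ = {0, 1, 2, \<dots>}\<close> is the type \<open>nat\<close>.
\<close>

definition dyn_system :: "'a::metric_space set \<Rightarrow> ('a \<Rightarrow> 'a) \<Rightarrow> bool" where
  "dyn_system X T \<longleftrightarrow> X \<noteq> {} \<and> compact X \<and> continuous_on X T \<and> T \<in> X \<rightarrow> X"

definition opene :: "'a::topological_space set \<Rightarrow> 'a set \<Rightarrow> bool" where
  "opene X U \<longleftrightarrow> openin (top_of_set X) U \<and> U \<noteq> {}"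

definition neighborhood :: "'a::topological_space set \<Rightarrow> 'a \<Rightarrow> 'a set \<Rightarrow> bool" where
  "neighborhood X x U \<longleftrightarrow> U \<subseteq> X \<and> (\<exists>V. openin (top_of_set X) V \<and> x \<in> V \<and> V \<subseteq> U)"

definition hitting_times :: "('a \<Rightarrow> 'a) \<Rightarrow> 'a set \<Rightarrow> 'a set \<Rightarrow> nat set" where
  "hitting_times T U V = {n. U \<inter> (T ^^ n) -` V \<noteq> {}}"

definition entering_times :: "('a \<Rightarrow> 'a) \<Rightarrow> 'a \<Rightarrow> 'a set \<Rightarrow> nat set" where
  "entering_times T x U = {n. (T ^^ n) x \<in> U}"

definition transitive_system :: "'a::metric_space set \<Rightarrow> ('a \<Rightarrow> 'a) \<Rightarrow> bool" where
  "transitive_system X T \<longleftrightarrow>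
     (\<forall>U V. opene X U \<longrightarrow> opene X V \<longrightarrow> infinite (hitting_times T U V))"

definition omega_limit :: "'a::metric_space set \<Rightarrow> ('a \<Rightarrow> 'a) \<Rightarrow> 'a \<Rightarrow> 'a set" where
  "omega_limit X T x =
     {y \<in> X. \<exists>r::nat \<Rightarrow> nat. strict_mono r \<and> (\<lambda>k. (T ^^ r k) x) \<longlonglongrightarrow> y}"

definition recurrent_point :: "'a::metric_space set \<Rightarrow> ('a \<Rightarrow> 'a) \<Rightarrow> 'a \<Rightarrow> bool" where
  "recurrent_point X T x \<longleftrightarrow> x \<in> X \<and> x \<in> omega_limit X T x"

definition Trans :: "'a::metric_space set \<Rightarrow> ('a \<Rightarrow> 'a) \<Rightarrow> 'a set" where
  "Trans X T = {x \<in> X. omega_limit X T x = X}"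

definition family :: "nat set set \<Rightarrow> bool" where
  "family \<F> \<longleftrightarrow> (\<forall>F1 F2. F1 \<subseteq> F2 \<longrightarrow> F1 \<in> \<F> \<longrightarrow> F2 \<in> \<F>) \<and>
     \<F> \<noteq> {} \<and> \<F> \<noteq> UNIV \<and> (\<forall>F\<in>\<F>. infinite F)"

definition IP_family :: "nat set set" where
  "IP_family = {F. \<exists>p::nat \<Rightarrow> nat. (\<forall>i. p i > 0) \<and>
     (\<forall>\<alpha>. finite \<alpha> \<longrightarrow> \<alpha> \<noteq> {} \<longrightarrow> (\<Sum>i\<in>\<alpha>. p i) \<in> F)}"

definition block_family :: "nat set set \<Rightarrow> nat set set" where
  "block_family \<F> = {F. \<exists>F'\<in>\<F>. \<forall>W. finite W \<longrightarrow> W \<subseteq> F' \<longrightarrow> (\<exists>m. (\<lambda>n. m + n) ` W \<subseteq> F)}"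

definition F_recurrent_point ::
    "nat set set \<Rightarrow> 'a::metric_space set \<Rightarrow> ('a \<Rightarrow> 'a) \<Rightarrow> 'a \<Rightarrow> bool" where
  "F_recurrent_point \<F> X T x \<longleftrightarrow>
     x \<in> X \<and> (\<forall>U. neighborhood X x U \<longrightarrow> entering_times T x U \<in> \<F>)"

definition F_Trans ::
    "nat set set \<Rightarrow> 'a::metric_space set \<Rightarrow> ('a \<Rightarrow> 'a) \<Rightarrow> 'a set" where
  "F_Trans \<F> X T = {x \<in> X. \<forall>U. opene X U \<longrightarrow> entering_times T x U \<in> \<F>}"

definition F_point_transitive ::
    "nat set set \<Rightarrow> 'a::metric_space set \<Rightarrow> ('a \<Rightarrow> 'a) \<Rightarrow> bool" where
  "F_point_transitive \<F> X T \<longleftrightarrow> F_Trans \<F> X T \<noteq> {}"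

definition F_point_center ::
    "nat set set \<Rightarrow> 'a::metric_space set \<Rightarrow> ('a \<Rightarrow> 'a) \<Rightarrow> bool" where
  "F_point_center \<F> X T \<longleftrightarrow>
     (\<forall>U. opene X U \<longrightarrow> (\<exists>x\<in>U. entering_times T x U \<in> \<F>))"

end

theory Submission
  imports Defs
begin

text \<open>
  A point is transitive iff it enters every opene set infinitely often; such points exist in a
  transitive system by the Baire category theorem. For a recurrent point \<open>x\<close> with open neighborhood
  \<open>V\<close>, shrink \<open>V\<close> successively to \<open>V' = V \<inter> T\<^sup>-\<^sup>p V\<close> with \<open>p > 0\<close> a return time of \<open>x\<close> to \<open>V\<close>;
  the return times chosen along the way generate an IP set of entering times. Finally, a finite set
  of entering times of one point is shared by all points near it, so a transitive point, passing
  close to an \<open>\<F>\<close>-transitive point, inherits finite blocks of its entering times up to translation.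
\<close>

section \<open>IP sets, block families and topological preliminaries\<close>

lemma infinite_IP:
  assumes "F \<in> IP_family"
  shows "infinite F"
proof -
  obtain p :: "nat \<Rightarrow> nat" where pos: "\<And>i. p i > 0"
    and p: "\<And>\<alpha>. finite \<alpha> \<Longrightarrow> \<alpha> \<noteq> {} \<Longrightarrow> (\<Sum>i\<in>\<alpha>. p i) \<in> F"
    using assms unfolding IP_family_def by blast
  \<comment> \<open>Positive summands push the sums over initial segments past every bound.\<close>
  have "m \<le> (\<Sum>i\<le>m. p i)" for m
  proof (induction m)
    case (Suc m)
    then show ?case using pos[of "Suc m"] by simp
  qed simp
  moreover have "(\<Sum>i\<le>m. p i) \<in> F" for m
    by (rule p) auto
  ultimately show ?thesis
    unfolding infinite_nat_iff_unbounded_le by blast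
qed

text \<open>A finite \<open>F\<close> has no room for an injective translate of a block with more
  than \<open>card F\<close> elements.\<close>

lemma infinite_block_family:
  assumes "\<And>F. F \<in> \<F> \<Longrightarrow> infinite F" and "F \<in> block_family \<F>"
  shows "infinite F"
proof
  assume fin: "finite F"
  obtain F' where F': "F' \<in> \<F>"
    and blocks: "\<And>W. finite W \<Longrightarrow> W \<subseteq> F' \<Longrightarrow> \<exists>m. (\<lambda>n. m + n) ` W \<subseteq> F"
    using assms(2) unfolding block_family_def by blast
  obtain W where W: "finite W" "card W = Suc (card F)" "W \<subseteq> F'"
    using infinite_arbitrarily_large[OF assms(1)[OF F']] by blast
  obtain m where "(\<lambda>n. m + n) ` W \<subseteq> F"
    using blocks W by blast
  then have "card ((\<lambda>n. m + n) ` W) \<le> card F"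
    using fin by (rule card_mono[rotated])
  then show False
    using W by (simp add: card_image)
qed

text \<open>The single shift \<open>n\<close> serves every finite block at once.\<close>

lemma block_family_translate:
  assumes "F' \<in> \<F>" and "(\<lambda>k. n + k) ` F' \<subseteq> F"
  shows "F \<in> block_family \<F>"
  using assms unfolding block_family_def by blast

lemma entering_times_funpow:
  "k \<in> entering_times T ((T ^^ n) x) U \<longleftrightarrow> n + k \<in> entering_times T x U"
  \<comment> \<open>After commuting \<open>n + k\<close>, \<open>funpow_add\<close> puts the first
    \<open>n\<close> steps innermost.\<close>
  by (subst add.commute) (simp add: entering_times_def funpow_add)

text \<open>Balls around the points of finite \<open>1/n\<close>-nets; the ambient type need not be second countable.\<close>

lemma compact_countable_pi_base:
  fixes X :: "'a::metric_space set"
  assumes "compact X"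
  obtains \<B> where "countable \<B>" "\<And>B. B \<in> \<B> \<Longrightarrow> opene X B"
    "\<And>U. opene X U \<Longrightarrow> \<exists>B\<in>\<B>. B \<subseteq> U"
proof -
  have "\<exists>C. finite C \<and> C \<subseteq> X \<and> X \<subseteq> (\<Union>c\<in>C. ball c (1 / real (Suc k)))" for k
    using seq_compact_imp_totally_bounded assms compact_eq_seq_compact_metric
    by (metis divide_pos_pos of_nat_0_less_iff zero_less_Suc zero_less_one)
  then obtain C where C: "\<And>k. finite (C k)" "\<And>k. C k \<subseteq> X"
    "\<And>k. X \<subseteq> (\<Union>c\<in>C k. ball c (1 / real (Suc k)))"
    by metis
  define \<B> where "\<B> = (\<Union>k. (\<lambda>c. X \<inter> ball c (1 / real (Suc k))) ` C k)"
  show thesis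
  proof
    show "countable \<B>"
      unfolding \<B>_def using C(1) by (auto intro: countable_finite)
    show "opene X B" if "B \<in> \<B>" for B
      using that C(2) unfolding \<B>_def opene_def by (fastforce simp: openin_open_Int)
    show "\<exists>B\<in>\<B>. B \<subseteq> U" if U: "opene X U" for U
    proof -
      obtain y where y: "y \<in> U" "y \<in> X"
        using U openin_imp_subset unfolding opene_def by blast
      obtain e where e: "e > 0" "ball y e \<inter> X \<subseteq> U"
        using U y unfolding opene_def openin_contains_ball by blast
      \<comment> \<open>Half the radius, since the net point \<open>c\<close> is itself up to
        \<open>1 / real (Suc k)\<close> away from \<open>y\<close>.\<close>
      obtain k where k: "1 / real (Suc k) < e / 2"
        using reals_Archimedean[of "e / 2"] e by (auto simp: inverse_eq_divide)
      obtain c where c: "c \<in> C k" "dist c y < 1 / real (Suc k)"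
        using C(3)[of k] y by auto
      have "ball c (1 / real (Suc k)) \<subseteq> ball y e"
      proof
        fix z assume "z \<in> ball c (1 / real (Suc k))"
        then show "z \<in> ball y e"
          using dist_triangle[of y z c] c(2) k by (simp add: dist_commute)
      qed
      then have "X \<inter> ball c (1 / real (Suc k)) \<subseteq> U"
        using e by blast
      then show ?thesis
        using c(1) unfolding \<B>_def by blast
    qed
  qed
qed

text \<open>Trades convergent subsequences for infinitely many visits to each ball, the form in
  which limit points become statements about entering times.\<close>

lemma omega_limit_iff:
  "y \<in> omega_limit X T x \<longleftrightarrow>
     y \<in> X \<and> (\<forall>e>0. infinite {n. dist ((T ^^ n) x) y < e})"
proof (intro iffI conjI allI impI; (elim conjE)?)
  assume y: "y \<in> omega_limit X T x"
  then show "y \<in> X" by (simp add: omega_limit_def)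
  fix e :: real assume "e > 0"
  obtain r :: "nat \<Rightarrow> nat" where r: "strict_mono r" "(\<lambda>k. (T ^^ r k) x) \<longlonglongrightarrow> y"
    using y unfolding omega_limit_def by blast
  obtain K where K: "\<And>k. k \<ge> K \<Longrightarrow> dist ((T ^^ r k) x) y < e"
    using tendstoD[OF r(2) \<open>e > 0\<close>] unfolding eventually_sequentially by blast
  have "infinite (r ` {K..})"
    using strict_mono_imp_inj_on[OF r(1)] infinite_Ici
    by (metis finite_imageD inj_on_subset subset_UNIV)
  moreover have "r ` {K..} \<subseteq> {n. dist ((T ^^ n) x) y < e}"
    using K by auto
  ultimately show "infinite {n. dist ((T ^^ n) x) y < e}"
    using finite_subset by blast
next
  assume "y \<in> X" and inf: "\<forall>e>0. infinite {n. dist ((T ^^ n) x) y < e}"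
  \<comment> \<open>Visits occur beyond every \<open>m\<close>, so times with shrinking errors can
    be chosen strictly increasing.\<close>
  have next_time: "\<exists>n>m. dist ((T ^^ n) x) y < 1 / real (Suc k)" for m k
    using inf infinite_nat_iff_unbounded[of "{n. dist ((T ^^ n) x) y < 1 / real (Suc k)}"]
    by simp
  have "\<exists>r. \<forall>k. dist ((T ^^ r k) x) y < 1 / real (Suc k) \<and> r k < r (Suc k)"
  proof (rule dependent_nat_choice)
    show "\<exists>n. dist ((T ^^ n) x) y < 1 / real (Suc 0)"
      using next_time by blast
  qed (use next_time in blast)
  then obtain r where r: "\<And>k. dist ((T ^^ r k) x) y < 1 / real (Suc k)" "\<And>k. r k < r (Suc k)"
    by blast
  have "(\<lambda>k. dist ((T ^^ r k) x) y) \<longlonglongrightarrow> 0"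
  proof (rule tendsto_sandwich[OF _ _ tendsto_const])
    show "(\<lambda>k. 1 / real (Suc k)) \<longlonglongrightarrow> 0"
      using LIMSEQ_inverse_real_of_nat by (simp add: inverse_eq_divide)
    show "\<forall>\<^sub>F k in sequentially. dist ((T ^^ r k) x) y \<le> 1 / real (Suc k)"
      using r(1) less_imp_le by (intro always_eventually) blast
  qed simp
  then have "(\<lambda>k. (T ^^ r k) x) \<longlonglongrightarrow> y"
    by (subst tendsto_dist_iff)
  then show "y \<in> omega_limit X T x"
    using \<open>y \<in> X\<close> r(2) unfolding omega_limit_def by (auto simp: strict_mono_Suc_iff)
qed

section \<open>Orbits and transitive points of a fixed system\<close>

context
  fixes X :: "'a::metric_space set" and T :: "'a \<Rightarrow> 'a"
  assumes system: "dyn_system X T"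
begin

lemma funpow_closed: "x \<in> X \<Longrightarrow> (T ^^ n) x \<in> X"
  using system by (induction n) (auto simp: dyn_system_def)

lemma continuous_on_funpow: "continuous_on X (T ^^ n)"
proof (induction n)
  case (Suc n)
  have "continuous_on ((T ^^ n) ` X) T"
    using system funpow_closed
    by (auto simp: dyn_system_def intro: continuous_on_subset)
  then show ?case
    using continuous_on_compose[OF Suc] by simp
qed simp

text \<open>\<open>T\<close> is unconstrained outside \<open>X\<close>, so the preimage is cut down
  to \<open>X\<close>.\<close>

lemma openin_funpow_preimage:
  "openin (top_of_set X) U \<Longrightarrow> openin (top_of_set X) (X \<inter> (T ^^ n) -` U)"
  using continuous_openin_preimage[OF continuous_on_funpow] funpow_closed by blast

lemma omega_limit_imp_infinite_entering_times:
  assumes "x \<in> X" "y \<in> omega_limit X T x" "openin (top_of_set X) U" "y \<in> U"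
  shows "infinite (entering_times T x U)"
proof -
  obtain e where e: "e > 0" "ball y e \<inter> X \<subseteq> U"
    using assms(3,4) unfolding openin_contains_ball by blast
  have "{n. dist ((T ^^ n) x) y < e} \<subseteq> entering_times T x U"
    using e(2) funpow_closed[OF assms(1)] unfolding entering_times_def
    by (auto simp: dist_commute)
  then show ?thesis
    using assms(2) e(1) finite_subset unfolding omega_limit_iff by blast
qed

text \<open>An opene set contains a limit point, near which the orbit returns infinitely often;
  conversely, relative balls about \<open>y\<close> test whether \<open>y\<close> is a limit
  point.\<close>

lemma Trans_iff:
  "x \<in> Trans X T \<longleftrightarrow> x \<in> X \<and> (\<forall>U. opene X U \<longrightarrow> infinite (entering_times T x U))"
proof (intro iffI conjI allI impI)
  assume x: "x \<in> Trans X T"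
  then show "x \<in> X" by (simp add: Trans_def)
  fix U assume U: "opene X U"
  then obtain y where "y \<in> U" "y \<in> X"
    using openin_imp_subset unfolding opene_def by blast
  with x U show "infinite (entering_times T x U)"
    by (intro omega_limit_imp_infinite_entering_times) (auto simp: Trans_def opene_def)
next
  assume x: "x \<in> X \<and> (\<forall>U. opene X U \<longrightarrow> infinite (entering_times T x U))"
  have "y \<in> omega_limit X T x" if "y \<in> X" for y
    unfolding omega_limit_iff
  proof (intro conjI allI impI that)
    fix e :: real assume "e > 0"
    with that have "opene X (X \<inter> ball y e)"
      by (auto simp: opene_def openin_open_Int)
    with x have "infinite (entering_times T x (X \<inter> ball y e))"
      by blast
    moreover have "entering_times T x (X \<inter> ball y e) \<subseteq> {n. dist ((T ^^ n) x) y < e}"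
      by (auto simp: entering_times_def dist_commute)
    ultimately show "infinite {n. dist ((T ^^ n) x) y < e}"
      using finite_subset by blast
  qed
  with x show "x \<in> Trans X T"
    unfolding Trans_def by (auto simp: omega_limit_def)
qed

text \<open>Starting later deletes only the times below \<open>n\<close> and shifts the others, so
  infinitely many remain.\<close>

lemma Trans_funpow:
  assumes "x \<in> Trans X T"
  shows "(T ^^ n) x \<in> Trans X T"
  unfolding Trans_iff
proof (intro conjI allI impI)
  show "(T ^^ n) x \<in> X"
    using assms funpow_closed by (simp add: Trans_def)
  fix U assume "opene X U"
  with assms have "infinite (entering_times T x U)"
    by (simp add: Trans_iff)
  moreover have "{n..} \<inter> entering_times T x U \<subseteq> (\<lambda>k. n + k) ` entering_times T ((T ^^ n) x) U"
    by (force simp: entering_times_funpow le_iff_add)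
  moreover have "entering_times T x U \<subseteq> {..<n} \<union> ({n..} \<inter> entering_times T x U)"
    by auto
  ultimately show "infinite (entering_times T ((T ^^ n) x) U)"
    by (meson finite_UnI finite_imageI finite_lessThan finite_subset)
qed

lemma Trans_imp_recurrent: "x \<in> Trans X T \<Longrightarrow> recurrent_point X T x"
  by (simp add: Trans_def recurrent_point_def)

section \<open>Recurrence along IP sets\<close>

lemma recurrent_imp_IP_recurrent:
  assumes "recurrent_point X T x"
  shows "F_recurrent_point IP_family X T x"
  unfolding F_recurrent_point_def
proof (intro conjI allI impI)
  show "x \<in> X" using assms by (simp add: recurrent_point_def)
  fix U assume "neighborhood X x U"
  then obtain V0 where V0: "openin (top_of_set X) V0" "x \<in> V0" "V0 \<subseteq> U"
    unfolding neighborhood_def by blast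
  \<comment> \<open>The invariant of the construction: by recurrence, \<open>x\<close> enters every
    set satisfying \<open>P\<close> infinitely often.\<close>
  define P where "P V \<longleftrightarrow> openin (top_of_set X) V \<and> x \<in> V \<and> V \<subseteq> V0" for V
  have "\<exists>V. \<forall>k. P (V k) \<and> (\<exists>p>0. V (Suc k) = V k \<inter> (T ^^ p) -` V k)"
  proof (rule dependent_nat_choice)
    show "\<exists>V. P V" using V0 by (auto simp: P_def)
    fix V :: "'a set" and k :: nat
    assume V: "P V"
    then have "infinite (entering_times T x V)"
      using assms omega_limit_imp_infinite_entering_times
      by (auto simp: P_def recurrent_point_def)
    \<comment> \<open>Time 0 is always an entering time here; infinitude supplies a positive
      one.\<close>
    then obtain p where p: "p > 0" "(T ^^ p) x \<in> V"
      unfolding infinite_nat_iff_unbounded entering_times_def by blast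
    have "V \<inter> (T ^^ p) -` V = V \<inter> (X \<inter> (T ^^ p) -` V)"
      using V openin_imp_subset unfolding P_def by blast
    then have "P (V \<inter> (T ^^ p) -` V)"
      using V p openin_funpow_preimage by (auto simp: P_def intro: openin_Int)
    with p show "\<exists>V'. P V' \<and> (\<exists>p>0. V' = V \<inter> (T ^^ p) -` V)"
      by blast
  qed
  then obtain V p where V: "\<And>k. P (V k)" and pos: "\<And>k. p k > 0"
    and step: "\<And>k. V (Suc k) = V k \<inter> (T ^^ p k) -` V k"
    by metis
  \<comment> \<open>The largest index of the sum must act first, as it leads from \<open>V (Suc m)\<close> into \<open>V m\<close>.\<close>
  have sums: "(T ^^ (\<Sum>i\<in>\<alpha>. p i)) y \<in> V 0" if "\<alpha> \<subseteq> {..<m}" "y \<in> V m" for \<alpha> m y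
    using that
  proof (induction m arbitrary: \<alpha> y)
    case (Suc m)
    have fin: "finite \<alpha>" using Suc.prems(1) finite_subset by blast
    have sub: "\<alpha> - {m} \<subseteq> {..<m}" using Suc.prems(1) by (auto simp: less_Suc_eq)
    show ?case
    proof (cases "m \<in> \<alpha>")
      case True
      have "(T ^^ (\<Sum>i\<in>\<alpha> - {m}. p i)) ((T ^^ p m) y) \<in> V 0"
        using Suc.prems(2) step by (intro Suc.IH sub) auto
      then show ?thesis
        using sum.remove[OF fin True, of p] funpow_add[of "\<Sum>i\<in>\<alpha> - {m}. p i" "p m" T]
        by (simp add: add.commute)
    next
      case False
      then show ?thesis
        using Suc.IH[OF sub, of y] Suc.prems(2) step by auto
    qed
  qed simp
  have "(\<Sum>i\<in>\<alpha>. p i) \<in> entering_times T x U" if fin: "finite \<alpha>" for \<alpha>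
  proof -
    \<comment> \<open>Any bound \<open>m\<close> on the indices will do, because \<open>x\<close>
      lies in every \<open>V m\<close>.\<close>
    obtain m where "\<alpha> \<subseteq> {..<m}"
      using fin finite_nat_iff_bounded by blast
    moreover have "x \<in> V m" "V 0 \<subseteq> U"
      using V[of m] V[of 0] V0(3) by (auto simp: P_def)
    ultimately show ?thesis
      using sums unfolding entering_times_def by blast
  qed
  then show "entering_times T x U \<in> IP_family"
    using pos unfolding IP_family_def by blast
qed

section \<open>Transitive systems and transitive points\<close>

lemma transitive_imp_Trans_nonempty:
  assumes "transitive_system X T"
  shows "Trans X T \<noteq> {}"
proof -
  have X: "X \<noteq> {}" "compact X"
    using system by (auto simp: dyn_system_def)
  obtain \<B> where \<B>: "countable \<B>" "\<And>B. B \<in> \<B> \<Longrightarrow> opene X B"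
    "\<And>U. opene X U \<Longrightarrow> \<exists>B\<in>\<B>. B \<subseteq> U"
    using compact_countable_pi_base[OF X(2)] by blast
  \<comment> \<open>Lying in \<open>G B k\<close> for all \<open>k\<close> means entering
    \<open>B\<close> infinitely often, so the points common to all these sets are the transitive
    points.\<close>
  define G where "G B k = (\<Union>n\<in>{k..}. X \<inter> (T ^^ n) -` B)" for B and k :: nat
  have "top_of_set X closure_of \<Inter>((\<lambda>(B, k). G B k) ` (\<B> \<times> UNIV)) = topspace (top_of_set X)"
  proof (rule Baire_category)
    \<comment> \<open>Compactness yields the locally compact branch.\<close>
    show "completely_metrizable_space (top_of_set X)
        \<or> locally_compact_space (top_of_set X) \<and> regular_space (top_of_set X)"
      using X(2) by (simp add: compact_imp_locally_compact_space compact_space_subtopology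
          metrizable_imp_regular_space metrizable_space_subtopology metrizable_space_euclidean)
    show "countable ((\<lambda>(B, k). G B k) ` (\<B> \<times> UNIV))"
      using \<B>(1) by simp
    fix D assume "D \<in> (\<lambda>(B, k). G B k) ` (\<B> \<times> UNIV)"
    then obtain B k where D: "D = G B k" "B \<in> \<B>" by auto
    have "openin (top_of_set X) D"
      unfolding D(1) G_def
      using \<B>(2)[OF D(2)] openin_funpow_preimage by (intro openin_Union) (auto simp: opene_def)
    \<comment> \<open>Density of \<open>D\<close>: \<open>U\<close> hits \<open>B\<close> at
      infinitely many times, hence at some time not below \<open>k\<close>.\<close>
    moreover have "\<exists>y\<in>D. y \<in> U" if "openin (top_of_set X) U" "x \<in> U" for x U
    proof -
      have U: "opene X U" "U \<subseteq> X"
        using that openin_imp_subset by (auto simp: opene_def)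
      have "infinite (hitting_times T U B)"
        using assms U(1) \<B>(2)[OF D(2)] unfolding transitive_system_def by blast
      then obtain n where "n \<ge> k" "n \<in> hitting_times T U B"
        unfolding infinite_nat_iff_unbounded_le by blast
      then show ?thesis
        using U(2) unfolding D(1) G_def hitting_times_def by blast
    qed
    ultimately show "openin (top_of_set X) D \<and> top_of_set X closure_of D = topspace (top_of_set X)"
      unfolding closure_of_def by auto
  qed
  then have "\<Inter>((\<lambda>(B, k). G B k) ` (\<B> \<times> UNIV)) \<noteq> {}"
    using X(1) by (metis closure_of_empty topspace_euclidean_subtopology)
  then obtain x where x: "\<And>B k. B \<in> \<B> \<Longrightarrow> x \<in> G B k"
    by auto
  \<comment> \<open>Membership of \<open>x\<close> in \<open>X\<close> is read off from one of the
    sets \<open>G B0 0\<close>, so the pi-base must be seen to have an element.\<close>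
  obtain B0 where "B0 \<in> \<B>"
    using \<B>(3)[of X] X(1) by (auto simp: opene_def)
  then have "x \<in> X"
    using x[of B0 0] by (auto simp: G_def)
  have "infinite (entering_times T x U)" if U: "opene X U" for U
  proof -
    obtain B where "B \<in> \<B>" "B \<subseteq> U"
      using \<B>(3)[OF U] by blast
    then have "\<exists>n\<ge>k. n \<in> entering_times T x U" for k
      using x[of B k] unfolding G_def entering_times_def by auto
    then show ?thesis
      unfolding infinite_nat_iff_unbounded_le by blast
  qed
  with \<open>x \<in> X\<close> show ?thesis
    using Trans_iff by blast
qed

text \<open>The orbit reaches \<open>U\<close> at some point, which is again transitive and so
  enters \<open>V\<close> infinitely often.\<close>

lemma Trans_nonempty_imp_transitive:
  assumes "x \<in> Trans X T"
  shows "transitive_system X T"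
  unfolding transitive_system_def
proof (intro allI impI)
  fix U V assume "opene X U" "opene X V"
  then obtain n where n: "(T ^^ n) x \<in> U"
    using assms finite.emptyI unfolding Trans_iff entering_times_def
    by (metis (mono_tags, lifting) Collect_empty_eq)
  have "entering_times T ((T ^^ n) x) V \<subseteq> hitting_times T U V"
    using n by (auto simp: entering_times_def hitting_times_def)
  moreover have "infinite (entering_times T ((T ^^ n) x) V)"
    using Trans_funpow[OF assms] \<open>opene X V\<close> by (simp add: Trans_iff)
  ultimately show "infinite (hitting_times T U V)"
    using finite_subset by blast
qed

text \<open>The orbit point found in \<open>U\<close> is itself transitive, hence recurrent, hence
  IP-recurrent, and \<open>U\<close> is one of its neighborhoods.\<close>

lemma Trans_visits_IP:
  assumes "x \<in> Trans X T" "opene X U"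
  obtains n where "(T ^^ n) x \<in> U" "entering_times T ((T ^^ n) x) U \<in> IP_family"
proof -
  have "infinite (entering_times T x U)"
    using assms by (simp add: Trans_iff)
  then obtain n where n: "(T ^^ n) x \<in> U"
    using infinite_imp_nonempty unfolding entering_times_def by blast
  have "neighborhood X ((T ^^ n) x) U"
    using n assms(2) openin_imp_subset unfolding neighborhood_def opene_def by blast
  then have "entering_times T ((T ^^ n) x) U \<in> IP_family"
    using recurrent_imp_IP_recurrent Trans_imp_recurrent Trans_funpow[OF assms(1)]
    unfolding F_recurrent_point_def by blast
  with n show thesis by (rule that)
qed

section \<open>Transitivity in terms of IP sets and their blocks\<close>

lemma transitive_imp_IP_point_center:
  assumes "transitive_system X T"
  shows "F_point_center IP_family X T"
proof -
  obtain x where "x \<in> Trans X T"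
    using transitive_imp_Trans_nonempty[OF assms] by blast
  then show ?thesis
    unfolding F_point_center_def by (metis Trans_visits_IP)
qed

text \<open>Stated for any collection of infinite sets, so that it applies directly to block
  families.\<close>

lemma F_Trans_subset_Trans:
  assumes "\<And>F. F \<in> \<F> \<Longrightarrow> infinite F"
  shows "F_Trans \<F> X T \<subseteq> Trans X T"
  using assms unfolding F_Trans_def by (auto simp: Trans_iff)

text \<open>Forward, the entering times of a transitive point contain a shift of the IP set
  belonging to some point of its orbit. Backward, block IP sets are infinite, which forces
  transitivity of the point.\<close>

lemma transitive_iff_block_IP_point_transitive:
  "transitive_system X T \<longleftrightarrow> F_point_transitive (block_family IP_family) X T"
proof
  assume "transitive_system X T"
  then obtain x where x: "x \<in> Trans X T"
    using transitive_imp_Trans_nonempty by blast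
  have "entering_times T x U \<in> block_family IP_family" if U: "opene X U" for U
  proof -
    obtain n where "entering_times T ((T ^^ n) x) U \<in> IP_family"
      using Trans_visits_IP[OF x U] by blast
    then show ?thesis
      by (rule block_family_translate[where n = n]) (auto simp: entering_times_funpow)
  qed
  with x show "F_point_transitive (block_family IP_family) X T"
    by (auto simp: F_point_transitive_def F_Trans_def Trans_def)
next
  assume "F_point_transitive (block_family IP_family) X T"
  moreover have "F_Trans (block_family IP_family) X T \<subseteq> Trans X T"
    by (intro F_Trans_subset_Trans infinite_block_family[OF infinite_IP])
  ultimately show "transitive_system X T"
    using Trans_nonempty_imp_transitive unfolding F_point_transitive_def by blast
qed

section \<open>Point transitivity for general families\<close>

lemma F_point_transitive_imp_F_point_center:
  assumes "family \<F>" "F_point_transitive \<F> X T"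
  shows "F_point_center \<F> X T"
  unfolding F_point_center_def
proof (intro allI impI)
  fix U assume U: "opene X U"
  obtain x where x: "x \<in> X" "\<And>V. opene X V \<Longrightarrow> entering_times T x V \<in> \<F>"
    using assms(2) unfolding F_point_transitive_def F_Trans_def by blast
  have "infinite (entering_times T x U)"
    using assms(1) x(2)[OF U] by (simp add: family_def)
  then obtain n where n: "(T ^^ n) x \<in> U"
    using infinite_imp_nonempty unfolding entering_times_def by blast
  \<comment> \<open>The orbit of \<open>x\<close> enters this preimage at the same times as the
    orbit of \<open>(T ^^ n) x\<close> enters \<open>U\<close>, so \<open>(T ^^ n) x\<close> is the
    required point.\<close>
  have "opene X (X \<inter> (T ^^ n) -` U)"
    using U n x(1) openin_funpow_preimage by (auto simp: opene_def)
  then have "entering_times T x (X \<inter> (T ^^ n) -` U) \<in> \<F>"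
    by (rule x(2))
  also have "entering_times T x (X \<inter> (T ^^ n) -` U) = entering_times T ((T ^^ n) x) U"
    using funpow_closed[OF x(1)]
    by (auto simp: entering_times_def funpow_add[symmetric, THEN fun_cong, unfolded o_apply] add.commute)
  finally show "\<exists>y\<in>U. entering_times T y U \<in> \<F>"
    using n by blast
qed

lemma Trans_subset_F_Trans_block:
  assumes "F_point_transitive \<F> X T"
  shows "Trans X T \<subseteq> F_Trans (block_family \<F>) X T"
proof
  fix x assume x: "x \<in> Trans X T"
  obtain z where z: "z \<in> X" "\<And>U. opene X U \<Longrightarrow> entering_times T z U \<in> \<F>"
    using assms unfolding F_point_transitive_def F_Trans_def by blast
  have "entering_times T x U \<in> block_family \<F>" if U: "opene X U" for U
    unfolding block_family_def
  \<comment> \<open>The member of \<open>\<F>\<close> whose blocks are copied is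
    \<open>entering_times T z U\<close>.\<close>
  proof (intro CollectI bexI[OF _ z(2)[OF U]] allI impI)
    fix W assume W: "finite W" "W \<subseteq> entering_times T z U"
    \<comment> \<open>Points sharing with \<open>z\<close> the entering times in \<open>W\<close>;
      the leading \<open>X\<close> makes \<open>V\<close> equal to \<open>X\<close> when
      \<open>W\<close> is empty, the base case of the induction.\<close>
    define V where "V = X \<inter> (\<Inter>w\<in>W. X \<inter> (T ^^ w) -` U)"
    have "openin (top_of_set X) V"
      unfolding V_def using W(1)
    proof (induction W)
      case (insert w W)
      have "X \<inter> (\<Inter>w\<in>insert w W. X \<inter> (T ^^ w) -` U)
          = (X \<inter> (T ^^ w) -` U) \<inter> (X \<inter> (\<Inter>w\<in>W. X \<inter> (T ^^ w) -` U))"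
        by auto
      then show ?case
        using insert U openin_funpow_preimage by (metis openin_Int opene_def)
    qed simp
    moreover have "z \<in> V"
      using z(1) W(2) by (auto simp: V_def entering_times_def)
    ultimately have "infinite (entering_times T x V)"
      using x unfolding Trans_iff opene_def by blast
    then obtain m where "(T ^^ m) x \<in> V"
      using infinite_imp_nonempty unfolding entering_times_def by blast
    then have "W \<subseteq> entering_times T ((T ^^ m) x) U"
      unfolding V_def entering_times_def by blast
    then show "\<exists>m. (\<lambda>n. m + n) ` W \<subseteq> entering_times T x U"
      by (intro exI[of _ m]) (auto simp: entering_times_funpow)
  qed
  with x show "x \<in> F_Trans (block_family \<F>) X T"
    by (simp add: F_Trans_def Trans_def)
qed

lemma F_Trans_block_eq_Trans:
  assumes "family \<F>" "F_point_transitive \<F> X T"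
  shows "F_Trans (block_family \<F>) X T = Trans X T"
proof
  show "F_Trans (block_family \<F>) X T \<subseteq> Trans X T"
    using assms(1)
    by (intro F_Trans_subset_Trans) (auto simp: family_def dest: infinite_block_family[rotated])
qed (rule Trans_subset_F_Trans_block[OF assms(2)])

end

theorem mainTheorem9:
  fixes X :: "'a::metric_space set" and T :: "'a \<Rightarrow> 'a"
  assumes "dyn_system X T"
  shows
    "((\<forall>x. recurrent_point X T x \<longrightarrow> F_recurrent_point IP_family X T x) \<and>
      (transitive_system X T \<longrightarrow> F_point_center IP_family X T) \<and>
      (transitive_system X T \<longleftrightarrow> F_point_transitive (block_family IP_family) X T)) \<and>
     (\<forall>\<F>. family \<F> \<longrightarrow>
        (F_point_transitive \<F> X T \<longrightarrow>
           F_point_center \<F> X T \<and> F_Trans (block_family \<F>) X T = Trans X T) \<and>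
        (block_family \<F> = \<F> \<longrightarrow>
           (F_point_transitive \<F> X T \<longleftrightarrow> F_Trans \<F> X T = Trans X T \<and> Trans X T \<noteq> {})))"
proof -
  have "F_point_transitive \<F> X T \<longleftrightarrow> F_Trans \<F> X T = Trans X T \<and> Trans X T \<noteq> {}"
    if "family \<F>" "block_family \<F> = \<F>" for \<F>
    using F_Trans_block_eq_Trans[OF assms that(1)] that(2) by (auto simp: F_point_transitive_def)
  then show ?thesis
    using recurrent_imp_IP_recurrent[OF assms] transitive_imp_IP_point_center[OF assms]
      transitive_iff_block_IP_point_transitive[OF assms]
      F_point_transitive_imp_F_point_center[OF assms] F_Trans_block_eq_Trans[OF assms]
    by blast
qed

end
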